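(* An integer sided triangle is primitive sub-Eisensteinian if and only if it is of the class of triangles whose sides are $m^2+mn+n^2$, $n^2+2mn$ and $m^2-n^2$, where $m$ and $n$ are relatively prime positive integers with $m>n>0$ and $m\not\equiv n \pmod 3$. Any such triangle is achieved exactly once, i.e. by exactly one such pair $(m,n)$.
   Context: A primitive sub-Eisensteinian triangle is an integer sided triangle with side lengths $(a,b,c)$ (positive integers) such that the angle opposite the side of length $a$ is $120^\circ$ and $\gcd(a,b,c)=1$. By the law of cosines, the angle condition says $a^2=b^2+c^2+bc$. In this statement a triangle is determined by its sides irrespective of the order in which the two sides adjacent to the $120^\circ$ angle are listed. *)

theory Defs
  imports "HOL-Analysis.Analysis" "HOL-Number_Theory.Cong" "HOL-Library.Multiset"
begin

text \<open>\<open>angle P Q R\<close> is the unoriented angle \<open>PQR\<close>, with vertex \<open>Q\<close>.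
  It is meaningful only if \<open>P\<close> and \<open>R\<close> are both distinct from \<open>Q\<close>.\<close>

definition angle :: "'a::real_inner \<Rightarrow> 'a \<Rightarrow> 'a \<Rightarrow> real" where
  "angle P Q R = arccos (((P - Q) \<bullet> (R - Q)) / (norm (P - Q) * norm (R - Q)))"

text \<open>The sides \<open>a\<close>, \<open>b\<close>, \<open>c\<close> lie opposite the vertices \<open>A\<close>, \<open>B\<close>, \<open>C\<close> respectively.\<close>

definition integer_sided_triangle ::
    "real^2 \<Rightarrow> real^2 \<Rightarrow> real^2 \<Rightarrow> int \<Rightarrow> int \<Rightarrow> int \<Rightarrow> bool" where
  "integer_sided_triangle A B C a b c \<longleftrightarrow>
     \<not> collinear {A, B, C} \<and> a > 0 \<and> b > 0 \<and> c > 0 \<and>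
     dist B C = of_int a \<and> dist C A = of_int b \<and> dist A B = of_int c"

text \<open>A triangle is determined up to congruence by its side lengths, so the property is stated
  for the lengths; \<open>2 * pi / 3\<close> is \<open>120\<close> degrees.\<close>

definition primitive_sub_eisensteinian :: "int \<Rightarrow> int \<Rightarrow> int \<Rightarrow> bool" where
  "primitive_sub_eisensteinian a b c \<longleftrightarrow>
     (\<exists>A B C. integer_sided_triangle A B C a b c \<and> angle B A C = 2 * pi / 3) \<and>
     Gcd {a, b, c} = 1"

definition admissible_pair :: "int \<Rightarrow> int \<Rightarrow> bool" where
  "admissible_pair m n \<longleftrightarrow> m > n \<and> n > 0 \<and> coprime m n \<and> \<not> [m = n] (mod 3)"

text \<open>The two sides adjacent to the \<open>120\<close> degree angle are compared as a multiset, because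
  they may be listed in either order.\<close>

definition sides_from_pair :: "int \<Rightarrow> int \<Rightarrow> int \<Rightarrow> int \<Rightarrow> int \<Rightarrow> bool" where
  "sides_from_pair m n a b c \<longleftrightarrow>
     a = m^2 + m * n + n^2 \<and> {#b, c#} = {#n^2 + 2 * m * n, m^2 - n^2#}"

end

theory Submission
  imports Defs
begin

text \<open>The \<open>120\<close> degree angle turns the geometric condition into the equation
  \<open>a\<^sup>2 = b\<^sup>2 + c\<^sup>2 + b c\<close> for positive integers without common factor (law of cosines in one
  direction, an explicit triangle in the other), and the rest is arithmetic.

  The key is the ratio \<open>(a + c) / b\<close>. For the sides \<open>b = n\<^sup>2 + 2 m n\<close> and \<open>c = m\<^sup>2 - n\<^sup>2\<close> it equals
  \<open>m / n\<close>, so the pair can be read off from the triangle. Conversely, reduce \<open>(a + c) / b\<close> to lowest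
  terms \<open>m / n\<close>. Factoring the equation as \<open>(a + c) (a - c) = b (b + c)\<close> then makes \<open>(a, b, c)\<close>
  proportional to the triple built from \<open>(m, n)\<close>. That triple is primitive unless
  \<open>m = n + 3 q\<close>, when it is three times a primitive one; in this case the primitive triple
  is the one built from \<open>(n + q, q)\<close>, with the two sides adjacent to the angle exchanged.

  Exchanging \<open>b\<close> and \<open>c\<close> replaces the ratio \<open>m / n\<close> by \<open>(m + 2 n) / (m - n)\<close>. If two admissible pairs
  gave the same triangle in opposite orders, they would be related by this map, which forces the
  two entries of one of them to be congruent modulo \<open>3\<close>. Hence a triangle comes from one pair only.\<close>

section \<open>Geometry of the 120 degree angle\<close>

lemma cos_two_thirds_pi: "cos (2 * pi / 3) = - 1 / 2"
proof -
  have "cos (2 * (pi / 3)) = 2 * (cos (pi / 3))\<^sup>2 - 1"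
    by (rule cos_double_cos)
  then show ?thesis by (simp add: cos_60 power2_eq_square)
qed

lemma cos_angle:
  assumes "P \<noteq> Q" "R \<noteq> Q"
  shows "norm (P - Q) * norm (R - Q) * cos (angle P Q R) = (P - Q) \<bullet> (R - Q)"
proof -
  have pos: "norm (P - Q) * norm (R - Q) > 0" using assms by simp
  have "\<bar>((P - Q) \<bullet> (R - Q)) / (norm (P - Q) * norm (R - Q))\<bar> \<le> 1"
    using Cauchy_Schwarz_ineq2[of "P - Q" "R - Q"] pos by (simp add: abs_mult)
  then show ?thesis using assms by (simp add: angle_def cos_arccos_abs)
qed

lemma law_of_cosines:
  assumes "P \<noteq> Q" "R \<noteq> Q"
  shows "(dist P R)\<^sup>2 = (dist P Q)\<^sup>2 + (dist R Q)\<^sup>2 - 2 * dist P Q * dist R Q * cos (angle P Q R)"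
proof -
  have "(norm (P - R))\<^sup>2 = (norm ((P - Q) - (R - Q)))\<^sup>2" by simp
  also have "\<dots> = (norm (P - Q))\<^sup>2 + (norm (R - Q))\<^sup>2 - 2 * ((P - Q) \<bullet> (R - Q))"
    by (simp only: power2_norm_eq_inner inner_diff_left inner_diff_right inner_commute)
      (simp add: inner_commute)
  finally show ?thesis using cos_angle[OF assms] by (simp add: dist_norm mult.assoc)
qed

text \<open>Placing the vertex of the angle at the origin and one side on the first axis gives
  explicit coordinates.\<close>

lemma ex_triangle_120:
  assumes pos: "a > 0" "b > 0" "c > 0" and eq: "a\<^sup>2 = b\<^sup>2 + c\<^sup>2 + b * c"
  shows "\<exists>A B C. integer_sided_triangle A B C a b c \<and> angle B A C = 2 * pi / 3"
proof -
  define A B C :: "real^2" where "A = vector [0, 0]" and "B = vector [of_int c, 0]"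
    and "C = vector [- of_int b / 2, of_int b * sqrt 3 / 2]"
  note coords = A_def B_def C_def
  have eq': "(of_int a :: real)\<^sup>2 = (of_int b)\<^sup>2 + (of_int c)\<^sup>2 + of_int b * of_int c"
    using arg_cong[OF eq, of "of_int :: int \<Rightarrow> real"] by simp
  have BC: "dist B C = of_int a"
  proof -
    have "(of_int c + of_int b / 2)\<^sup>2 + (of_int b * sqrt 3 / 2)\<^sup>2 = (of_int a :: real)\<^sup>2"
      unfolding eq' by (simp add: power2_eq_square field_simps)
    then show ?thesis using pos
      by (simp add: coords dist_norm norm_vec_def L2_set_def sum_2)
  qed
  have CA: "dist C A = of_int b"
  proof -
    have "(of_int b / 2)\<^sup>2 + (of_int b * sqrt 3 / 2)\<^sup>2 = (of_int b :: real)\<^sup>2"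
      by (simp add: power2_eq_square field_simps)
    then show ?thesis using pos
      by (simp add: coords dist_norm norm_vec_def L2_set_def sum_2)
  qed
  have AB: "dist A B = of_int c"
    using pos by (simp add: coords dist_norm norm_vec_def L2_set_def sum_2)
  have angle: "angle B A C = 2 * pi / 3"
  proof -
    have "norm (B - A) = of_int c" "norm (C - A) = of_int b"
      using AB CA by (simp_all add: dist_norm norm_minus_commute)
    moreover have "(B - A) \<bullet> (C - A) = - of_int b * of_int c / 2"
      by (simp add: coords inner_vec_def sum_2)
    ultimately have "(B - A) \<bullet> (C - A) / (norm (B - A) * norm (C - A)) = - 1 / 2"
      using pos by simp
    then have "angle B A C = arccos (- 1 / 2)" by (simp only: angle_def)
    also have "\<dots> = 2 * pi / 3"
      unfolding cos_two_thirds_pi[symmetric] by (rule arccos_cos) auto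
    finally show ?thesis .
  qed
  have "\<not> collinear {A, B, C}"
  proof
    assume "collinear {A, B, C}"
    moreover have "A = 0" by (simp add: A_def vec_eq_iff forall_2)
    moreover have "B \<noteq> 0" using pos by (simp add: B_def vec_eq_iff forall_2)
    ultimately obtain t where "C = t *\<^sub>R B"
      using pos CA by (auto simp: collinear_lemma)
    then have "C $ 2 = t * B $ 2" by simp
    then show False using pos by (simp add: coords)
  qed
  then show ?thesis
    using pos BC CA AB angle unfolding integer_sided_triangle_def by blast
qed

lemma primitive_sub_eisensteinian_iff:
  "primitive_sub_eisensteinian a b c \<longleftrightarrow>
     a > 0 \<and> b > 0 \<and> c > 0 \<and> a\<^sup>2 = b\<^sup>2 + c\<^sup>2 + b * c \<and> Gcd {a, b, c} = 1"
proof
  assume "primitive_sub_eisensteinian a b c"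
  then obtain A B C where tri: "integer_sided_triangle A B C a b c"
    and angle: "angle B A C = 2 * pi / 3" and gcd: "Gcd {a, b, c} = 1"
    unfolding primitive_sub_eisensteinian_def by blast
  from tri have pos: "a > 0" "b > 0" "c > 0"
    and sides: "dist B C = of_int a" "dist C A = of_int b" "dist B A = of_int c"
    by (auto simp: integer_sided_triangle_def dist_commute)
  have "B \<noteq> A" "C \<noteq> A" using pos sides by auto
  from law_of_cosines[OF this]
  have "(of_int a :: real)\<^sup>2 = of_int (b\<^sup>2 + c\<^sup>2 + b * c)"
    by (simp add: sides angle cos_two_thirds_pi)
  then have "a\<^sup>2 = b\<^sup>2 + c\<^sup>2 + b * c"
    by (simp only: of_int_power[symmetric] of_int_eq_iff)
  with pos gcd show "a > 0 \<and> b > 0 \<and> c > 0 \<and> a\<^sup>2 = b\<^sup>2 + c\<^sup>2 + b * c \<and> Gcd {a, b, c} = 1"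
    by blast
next
  assume "a > 0 \<and> b > 0 \<and> c > 0 \<and> a\<^sup>2 = b\<^sup>2 + c\<^sup>2 + b * c \<and> Gcd {a, b, c} = 1"
  then show "primitive_sub_eisensteinian a b c"
    using ex_triangle_120 by (auto simp: primitive_sub_eisensteinian_def)
qed

lemma primitive_sub_eisensteinian_swap:
  "primitive_sub_eisensteinian a b c \<longleftrightarrow> primitive_sub_eisensteinian a c b"
  unfolding primitive_sub_eisensteinian_iff insert_commute[of b c]
  by (auto simp only: mult.commute[of b c] add.commute[of "b\<^sup>2" "c\<^sup>2"])

section \<open>Arithmetic of the parametrization\<close>

text \<open>This is how an equality of fractions \<open>x / y = m / n\<close> is used when the right side is in lowest
  terms: it yields the factor that was cancelled.\<close>

lemma coprime_proportional:
  fixes m n x y :: int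
  assumes "coprime m n" "n \<noteq> 0" "m * y = n * x"
  obtains e where "x = m * e" "y = n * e"
proof -
  have "n dvd y * m" using assms(3) by (metis dvd_triv_left mult.commute)
  then have "n dvd y" using assms(1) by (simp add: coprime_dvd_mult_left_iff coprime_commute)
  then obtain e where e: "y = n * e" by (elim dvdE)
  then have "x = m * e" using assms(2,3) by simp
  with e show ?thesis by (rule that[rotated])
qed

lemma Gcd_eq_1_imp_common_factor_eq_1:
  fixes k :: int
  assumes "Gcd {k * x, k * y, k * z} = 1" "k > 0"
  shows "k = 1"
proof -
  have "k dvd Gcd {k * x, k * y, k * z}" by (rule Gcd_greatest) auto
  with assms show ?thesis by simp
qed

text \<open>A common prime factor \<open>p\<close> of the three sides cannot divide \<open>n\<close>, since the first side would
  make it divide \<open>m\<close> as well. Hence it divides \<open>n + 2 m\<close>; together with \<open>p\<close> dividing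
  \<open>m + n\<close> or \<open>m - n\<close> this leaves only \<open>p = 3\<close>, excluded by the congruence condition.\<close>

lemma admissible_pair_imp_Gcd_sides:
  assumes "admissible_pair m n"
  shows "Gcd {m\<^sup>2 + m * n + n\<^sup>2, n\<^sup>2 + 2 * m * n, m\<^sup>2 - n\<^sup>2} = 1" (is "Gcd ?S = 1")
proof (rule ccontr)
  from assms have cop: "coprime m n" and ncong: "\<not> 3 dvd m - n"
    by (auto simp: admissible_pair_def cong_iff_dvd_diff)
  assume "Gcd ?S \<noteq> 1"
  then have "\<not> is_unit (Gcd ?S)" using is_unit_normalize normalize_Gcd by metis
  moreover have "n\<^sup>2 < m\<^sup>2"
    using assms by (auto simp: admissible_pair_def intro: power_strict_mono)
  then have "Gcd ?S \<noteq> 0" by (auto simp: Gcd_0_iff)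
  ultimately obtain p where p: "prime p" "p dvd Gcd ?S" using prime_divisorE by metis
  then have dvds: "p dvd m\<^sup>2 + m * n + n\<^sup>2" "p dvd n * (n + 2 * m)" "p dvd (m + n) * (m - n)"
    by (auto simp: dvd_Gcd_iff algebra_simps power2_eq_square)
  have not_both: "\<not> (p dvd m \<and> p dvd n)"
    using cop p(1) by (meson coprime_common_divisor not_prime_unit)
  have "\<not> p dvd n"
  proof
    assume n: "p dvd n"
    then have "p dvd m\<^sup>2 + m * n + n\<^sup>2 - n * (m + n)" using dvds(1) by (intro dvd_diff) auto
    then have "p dvd m\<^sup>2" by (simp add: algebra_simps power2_eq_square)
    then show False using p(1) n not_both prime_dvd_power by blast
  qed
  then have p2: "p dvd n + 2 * m" using dvds(2) p(1) prime_dvd_mult_iff by blast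
  from dvds(3) p(1) consider "p dvd m + n" | "p dvd m - n"
    by (auto simp: prime_dvd_mult_iff)
  then show False
  proof cases
    case 1
    then have "p dvd (n + 2 * m) - (m + n)" using p2 by (intro dvd_diff)
    then have "p dvd m" by simp
    then show False using 1 not_both by (simp add: dvd_add_right_iff)
  next
    case 2
    then have "p dvd (n + 2 * m) - 2 * (m - n)" by (rule dvd_diff[OF p2 dvd_mult])
    then have "p dvd 3 * n" by simp
    then have "p dvd 3" using \<open>\<not> p dvd n\<close> p(1) prime_dvd_mult_iff by blast
    then have "p = 3" using p(1) by (simp add: primes_dvd_imp_eq)
    then show False using 2 ncong by simp
  qed
qed

lemma sides_from_pair_iff:
  "sides_from_pair m n a b c \<longleftrightarrow> a = m\<^sup>2 + m * n + n\<^sup>2 \<and>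
     (b = n\<^sup>2 + 2 * m * n \<and> c = m\<^sup>2 - n\<^sup>2 \<or> c = n\<^sup>2 + 2 * m * n \<and> b = m\<^sup>2 - n\<^sup>2)"
  by (auto simp: sides_from_pair_def add_eq_conv_ex)

lemma sides_from_pair_swap: "sides_from_pair m n a b c \<longleftrightarrow> sides_from_pair m n a c b"
  by (auto simp: sides_from_pair_iff)

lemma admissible_pair_imp_primitive:
  assumes "admissible_pair m n" "sides_from_pair m n a b c"
  shows "primitive_sub_eisensteinian a b c"
proof -
  from assms(1) have mn: "m > n" "n > 0" by (auto simp: admissible_pair_def)
  have pos: "m\<^sup>2 + m * n + n\<^sup>2 > 0" "n\<^sup>2 + 2 * m * n > 0" "m\<^sup>2 - n\<^sup>2 > 0"
    using mn by (auto intro!: add_pos_pos power_strict_mono)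
  have "(m\<^sup>2 + m * n + n\<^sup>2)\<^sup>2 = (n\<^sup>2 + 2 * m * n)\<^sup>2 + (m\<^sup>2 - n\<^sup>2)\<^sup>2 + (n\<^sup>2 + 2 * m * n) * (m\<^sup>2 - n\<^sup>2)"
    by algebra
  then have "primitive_sub_eisensteinian (m\<^sup>2 + m * n + n\<^sup>2) (n\<^sup>2 + 2 * m * n) (m\<^sup>2 - n\<^sup>2)"
    using pos admissible_pair_imp_Gcd_sides[OF assms(1)]
    unfolding primitive_sub_eisensteinian_iff by blast
  then show ?thesis
    using assms(2) primitive_sub_eisensteinian_swap unfolding sides_from_pair_iff by blast
qed

text \<open>With \<open>m / n\<close> the reduced form of \<open>(a + c) / b\<close> and \<open>g\<close>, \<open>h\<close> the factors by which
  \<open>(a + c, b) = g (m, n)\<close> and \<open>(b + c, a - c) = h (m, n)\<close>, eliminating the sides leaves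
  \<open>g (m + 2 n) = h (2 m + n)\<close>. The two coefficients are coprime or have greatest common
  divisor \<open>3\<close>, according to whether \<open>m\<close> and \<open>n\<close> differ modulo \<open>3\<close>. Either way
  \<open>g\<close> and \<open>h\<close> are the reduced coefficients times a common factor \<open>k\<close>, which then divides all
  three sides and so is \<open>1\<close>.\<close>

lemma primitive_imp_ex_pair:
  assumes "primitive_sub_eisensteinian a b c"
  shows "\<exists>m n. admissible_pair m n \<and> sides_from_pair m n a b c"
proof -
  from assms have pos: "a > 0" "b > 0" "c > 0" and eq: "a\<^sup>2 = b\<^sup>2 + c\<^sup>2 + b * c"
    and gcd: "Gcd {a, b, c} = 1"
    by (auto simp: primitive_sub_eisensteinian_iff)
  have "b\<^sup>2 < a\<^sup>2" using pos eq by (simp add: add_pos_pos)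
  then have "b < a" using pos by (simp add: power_less_imp_less_base)
  obtain g m n where mn: "a + c = m * g" "b = n * g" "coprime m n" and "g > 0"
    using gcd_coprime_exists[of "a + c" b] pos by (metis gcd_pos_int less_irrefl)
  have n: "n > 0" using mn(2) \<open>g > 0\<close> pos by (simp add: zero_less_mult_iff)
  have "n * g < m * g" using mn(1,2) \<open>b < a\<close> pos by linarith
  then have "m > n" using \<open>g > 0\<close> by simp
  have "g * (m * (a - c)) = g * (n * (b + c))"
    using eq mn(1,2) by algebra
  then have "m * (a - c) = n * (b + c)" using \<open>g > 0\<close> by simp
  then obtain h where h: "b + c = m * h" "a - c = n * h"
    using mn(3) n by (metis coprime_proportional less_irrefl)
  have gh: "h * (2 * m + n) = g * (m + 2 * n)" using mn(1,2) h by algebra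
  show ?thesis
  proof (cases "[m = n] (mod 3)")
    case False
    then have adm: "admissible_pair m n"
      using n \<open>m > n\<close> mn(3) by (simp add: admissible_pair_def)
    have "coprime (2 * m + n) (m + 2 * n)"
    proof (rule coprimeI)
      fix d assume d: "d dvd 2 * m + n" "d dvd m + 2 * n"
      have "d dvd 2 * (2 * m + n) - (m + 2 * n)" "d dvd 2 * (m + 2 * n) - (2 * m + n)"
        by (rule dvd_diff[OF dvd_mult[OF d(1)] d(2)], rule dvd_diff[OF dvd_mult[OF d(2)] d(1)])
      then have "d dvd gcd (3 * m) (3 * n)" by simp
      then have "d dvd 3" using mn(3) by (simp add: gcd_mult_left)
      show "is_unit d"
      proof (rule ccontr)
        assume "\<not> is_unit d"
        moreover have "irreducible (3 :: int)" by (intro prime_elem_imp_irreducible) simp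
        ultimately have "3 dvd d" using \<open>d dvd 3\<close> by (meson irreducibleD')
        then have "3 dvd 2 * m + n" using d(1) dvd_trans by blast
        then have "3 dvd m - n" by presburger
        then show False using False by (simp add: cong_iff_dvd_diff)
      qed
    qed
    then obtain k where k: "g = (2 * m + n) * k" "h = (m + 2 * n) * k"
      using gh n \<open>m > n\<close> coprime_proportional[of "2 * m + n" "m + 2 * n" h g]
      by (auto simp: mult.commute)
    have abc: "a = k * (m\<^sup>2 + m * n + n\<^sup>2)" "b = k * (n\<^sup>2 + 2 * m * n)" "c = k * (m\<^sup>2 - n\<^sup>2)"
      using mn(1,2) h unfolding k by (simp_all add: power2_eq_square algebra_simps)
    have "k > 0" using k(1) \<open>g > 0\<close> n \<open>m > n\<close> by (simp add: zero_less_mult_iff)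
    then have "k = 1" using gcd unfolding abc by (rule Gcd_eq_1_imp_common_factor_eq_1[rotated])
    then have "sides_from_pair m n a b c" using abc by (simp add: sides_from_pair_iff)
    with adm show ?thesis by blast
  next
    case True
    then obtain q where q: "m = n + 3 * q"
      by (metis cong_iff_lin cong_sym)
    \<comment> \<open>Now \<open>2 m + n = 3 (n + 2 q)\<close> and \<open>m + 2 n = 3 (n + q)\<close>; after cancelling \<open>3\<close>, the adjacent
        sides come out as those of the pair \<open>(n + q, q)\<close> in the opposite order.\<close>
    have q0: "q > 0" using q \<open>m > n\<close> by simp
    have cop: "coprime n (3 * q)"
      using mn(3) gcd_add1[of "3 * q" n] unfolding q
      by (simp only: coprime_iff_gcd_eq_1 add.commute gcd.commute)
    then have nq: "coprime n q" and n3: "\<not> 3 dvd n"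
      by (auto simp: coprime_commute prime_imp_coprime_int dest: coprime_common_divisor[of _ _ 3])
    have copq: "coprime (n + q) q" using nq by (simp add: coprime_iff_gcd_eq_1)
    have adm: "admissible_pair (n + q) q"
      using n q0 copq n3 by (simp add: admissible_pair_def cong_iff_dvd_diff)
    have "coprime (n + 2 * q) (n + q)"
      using copq gcd_add1[of q "n + q"]
      by (simp add: coprime_iff_gcd_eq_1 gcd.commute algebra_simps)
    moreover have "(n + 2 * q) * h = (n + q) * g" using gh unfolding q by algebra
    ultimately obtain k where k: "g = (n + 2 * q) * k" "h = (n + q) * k"
      using n q0 coprime_proportional[of "n + 2 * q" "n + q" h g] by auto
    have abc: "a = k * ((n + q)\<^sup>2 + (n + q) * q + q\<^sup>2)" "b = k * ((n + q)\<^sup>2 - q\<^sup>2)"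
      "c = k * (q\<^sup>2 + 2 * (n + q) * q)"
      using mn(1,2) h unfolding k q by (simp_all add: power2_eq_square algebra_simps)
    have "k > 0" using k(1) \<open>g > 0\<close> n q0 by (simp add: zero_less_mult_iff)
    then have "k = 1" using gcd unfolding abc by (rule Gcd_eq_1_imp_common_factor_eq_1[rotated])
    then have "sides_from_pair (n + q) q a b c" using abc by (simp add: sides_from_pair_iff)
    with adm show ?thesis by blast
  qed
qed

section \<open>Uniqueness of the pair\<close>

lemma admissible_pair_proportional_imp_eq:
  assumes "admissible_pair m n" "admissible_pair m' n'" "m * n' = n * m'"
  shows "m' = m \<and> n' = n"
proof -
  obtain e where e: "m' = m * e" "n' = n * e"
    using assms coprime_proportional[of m n n' m'] by (auto simp: admissible_pair_def)
  have "is_unit e" using assms(2) e by (auto simp: admissible_pair_def)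
  moreover have "e > 0" using assms(1,2) e by (auto simp: admissible_pair_def zero_less_mult_iff)
  ultimately show ?thesis using e by simp
qed

text \<open>Comparing the ratio \<open>(a + c) / b\<close> for the two pairs gives \<open>m / n = (m' + 2 n') / (m' - n')\<close>. If \<open>e\<close> is
  the factor cancelled on the right, then \<open>3 n' = (m - n) e\<close>. As \<open>3\<close> does not divide \<open>m - n\<close>, it
  divides \<open>e\<close> and hence \<open>m' - n' = n e\<close>, contrary to admissibility.\<close>

lemma admissible_pairs_not_swapped:
  assumes adm: "admissible_pair m n" "admissible_pair m' n'"
    and a: "m\<^sup>2 + m * n + n\<^sup>2 = m'\<^sup>2 + m' * n' + n'\<^sup>2"
    and b: "n\<^sup>2 + 2 * m * n = m'\<^sup>2 - n'\<^sup>2" and c: "m\<^sup>2 - n\<^sup>2 = n'\<^sup>2 + 2 * m' * n'"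
  shows False
proof -
  from adm have pos: "m > n" "n > 0" "m' > n'" "n' > 0" and cop: "coprime m n"
    and ncong: "\<not> 3 dvd m - n" "\<not> 3 dvd m' - n'"
    by (auto simp: admissible_pair_def cong_iff_dvd_diff)
  have ac: "m * (2 * m + n) = (m' + n') * (m' + 2 * n')" using a c by algebra
  have b': "n * (2 * m + n) = (m' + n') * (m' - n')" using b by algebra
  have "(m' + n') * (2 * m + n) * (m * (m' - n')) = (m' + n') * (2 * m + n) * (n * (m' + 2 * n'))"
    using ac b' by algebra
  then have "m * (m' - n') = n * (m' + 2 * n')" using pos by simp
  then obtain e where e: "m' + 2 * n' = m * e" "m' - n' = n * e"
    using cop pos coprime_proportional[of m n "m' - n'" "m' + 2 * n'"] by auto
  then have "3 * n' = (m - n) * e" by (simp add: algebra_simps)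
  then have "3 dvd (m - n) * e" by (metis dvd_triv_left)
  then have "3 dvd e" using ncong(1) prime_dvd_mult_iff[of "3::int"] by simp
  then show False using ncong(2) e(2) by simp
qed

lemma admissible_pair_unique_ordered:
  assumes adm: "admissible_pair m n" "admissible_pair m' n'"
    and abc: "a = m\<^sup>2 + m * n + n\<^sup>2" "b = n\<^sup>2 + 2 * m * n" "c = m\<^sup>2 - n\<^sup>2"
    and sides: "sides_from_pair m' n' a b c"
  shows "m' = m \<and> n' = n"
proof -
  from sides consider "b = n'\<^sup>2 + 2 * m' * n'" "c = m'\<^sup>2 - n'\<^sup>2"
    | "c = n'\<^sup>2 + 2 * m' * n'" "b = m'\<^sup>2 - n'\<^sup>2"
    by (auto simp: sides_from_pair_iff)
  then show ?thesis
  proof cases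
    case 1
    have a': "a = m'\<^sup>2 + m' * n' + n'\<^sup>2" using sides by (simp add: sides_from_pair_def)
    \<comment> \<open>The products below are \<open>a + c\<close> and \<open>b\<close>, so the two pairs have the same ratio
        \<open>(a + c) / b\<close>.\<close>
    have pos: "2 * m + n > 0" "2 * m' + n' > 0" using adm by (auto simp: admissible_pair_def)
    have "m * (2 * m + n) = m' * (2 * m' + n')" "n * (n + 2 * m) = n' * (n' + 2 * m')"
      using 1 a' abc by algebra+
    then have "(2 * m + n) * (2 * m' + n') * (m * n') = (2 * m + n) * (2 * m' + n') * (n * m')"
      by algebra
    then have "m * n' = n * m'" using pos by simp
    then show ?thesis by (rule admissible_pair_proportional_imp_eq[OF adm])
  next
    case 2
    then show ?thesis
      using admissible_pairs_not_swapped[OF adm] abc sides by (simp add: sides_from_pair_def)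
  qed
qed

lemma admissible_pair_unique:
  assumes "admissible_pair m n" "admissible_pair m' n'"
    and "sides_from_pair m n a b c" "sides_from_pair m' n' a b c"
  shows "m' = m \<and> n' = n"
  using assms admissible_pair_unique_ordered[of m n m' n' a b c]
    admissible_pair_unique_ordered[of m n m' n' a c b] sides_from_pair_swap[of m' n' a b c]
  by (auto simp: sides_from_pair_iff[of m n])

theorem corollary1:
  fixes a b c :: int
  shows "(primitive_sub_eisensteinian a b c \<longleftrightarrow>
           (\<exists>m n. admissible_pair m n \<and> sides_from_pair m n a b c)) \<and>
         (primitive_sub_eisensteinian a b c \<longrightarrow>
           (\<exists>!(m, n). admissible_pair m n \<and> sides_from_pair m n a b c))"
proof (intro conjI impI)
  show "primitive_sub_eisensteinian a b c \<longleftrightarrow>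
      (\<exists>m n. admissible_pair m n \<and> sides_from_pair m n a b c)"
    using primitive_imp_ex_pair admissible_pair_imp_primitive by blast
next
  assume "primitive_sub_eisensteinian a b c"
  then obtain m n where "admissible_pair m n" "sides_from_pair m n a b c"
    using primitive_imp_ex_pair by blast
  then show "\<exists>!(m, n). admissible_pair m n \<and> sides_from_pair m n a b c"
    using admissible_pair_unique by (intro ex1I[of _ "(m, n)"]) auto
qed

end
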